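(* Let $1\le p\le n$ and let $S$ be one of the semigroups $RSS_n(p)$ (in which case $p\ge 2$), $RLS_n(p)$, $K(n,p)$, $M(n,p)$. Then every element of $S$ of height $p$ can be expressed as a product of idempotents of $S$, each of height $p$.
   Context: Let $[n]=\{1,2,\ldots,n\}$ with its usual order. A partial transformation of $[n]$ is a map $\alpha$ whose domain $\mathrm{Dom}\,\alpha$ and image $\mathrm{Im}\,\alpha$ are subsets of $[n]$ (the empty map is allowed); maps are written on the right and composed left to right: $x(\alpha\beta)=(x\alpha)\beta$. $\alpha$ is isotone if $x\le y$ implies $x\alpha\le y\alpha$ for all $x,y\in\mathrm{Dom}\,\alpha$, and order-decreasing if $x\alpha\le x$ for all $x\in\mathrm{Dom}\,\alpha$. $\mathcal{LS}_n$ is the semigroup of all isotone order-decreasing partial transformations of $[n]$, and $\mathcal{SS}_n=\{\alpha\in\mathcal{LS}_n : 1\in\mathrm{Dom}\,\alpha\}$. The height of $\alpha$ is $|\mathrm{Im}\,\alpha|$. $K(n,p)=\{\alpha\in\mathcal{LS}_n: |\mathrm{Im}\,\alpha|\le p\}$ and $M(n,p)=\{\alpha\in\mathcal{SS}_n: |\mathrm{Im}\,\alpha|\le p\}$ are two-sided ideals of $\mathcal{LS}_n$ and $\mathcal{SS}_n$ respectively. $RLS_n(p)=K(n,p)/K(n,p-1)$ (for $p\ge 1$) and $RSS_n(p)=M(n,p)/M(n,p-1)$ (for $p\ge 2$) are the Rees quotient semigroups: their nonzero elements are the elements of $\mathcal{LS}_n$ (resp. $\mathcal{SS}_n$) of height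 exactly $p$, and the product of two nonzero elements is their composite if it has height $p$, and $0$ otherwise. *)

theory Defs
  imports Main
begin

text \<open>HOL-Algebra has no structure for semigroups without identity (its smallest
  multiplicative record carries a unit), so we use a carrier together with a multiplication.\<close>

record 'a sgrp =
  carrier :: "'a set"
  mult :: "'a \<Rightarrow> 'a \<Rightarrow> 'a"

definition semigroup_on :: "'a sgrp \<Rightarrow> bool" where
  "semigroup_on S \<longleftrightarrow>
     (\<forall>x\<in>carrier S. \<forall>y\<in>carrier S. mult S x y \<in> carrier S) \<and>
     (\<forall>x\<in>carrier S. \<forall>y\<in>carrier S. \<forall>z\<in>carrier S.
        mult S (mult S x y) z = mult S x (mult S y z))"

definition two_sided_ideal :: "'a sgrp \<Rightarrow> 'a set \<Rightarrow> bool" where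
  "two_sided_ideal S I \<longleftrightarrow> I \<subseteq> carrier S \<and>
     (\<forall>x\<in>I. \<forall>s\<in>carrier S. mult S s x \<in> I \<and> mult S x s \<in> I)"

definition idempotents :: "'a sgrp \<Rightarrow> 'a set" where
  "idempotents S = {e \<in> carrier S. mult S e e = e}"

definition products_of :: "'a sgrp \<Rightarrow> 'a set \<Rightarrow> 'a set" where
  "products_of S A = {foldl (mult S) e es | e es. e \<in> A \<and> set es \<subseteq> A}"

text \<open>The Rees quotient \<open>S / I\<close>: the class \<open>I\<close> is the zero, represented by \<^term>\<open>None\<close>;
  the remaining classes are singletons, represented by \<open>Some\<close> of their element.\<close>

definition rees_quotient :: "'a sgrp \<Rightarrow> 'a set \<Rightarrow> 'a option sgrp" where
  "rees_quotient S I =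
     \<lparr> carrier = insert None (Some ` (carrier S - I)),
       mult = (\<lambda>x y. case (x, y) of
           (Some a, Some b) \<Rightarrow> if mult S a b \<in> I then None else Some (mult S a b)
         | _ \<Rightarrow> None) \<rparr>"

type_synonym ptrans = "nat \<rightharpoonup> nat"

definition partial_transformation :: "nat \<Rightarrow> ptrans \<Rightarrow> bool" where
  "partial_transformation n \<alpha> \<longleftrightarrow> dom \<alpha> \<subseteq> {1..n} \<and> ran \<alpha> \<subseteq> {1..n}"

definition isotone :: "ptrans \<Rightarrow> bool" where
  "isotone \<alpha> \<longleftrightarrow> (\<forall>x\<in>dom \<alpha>. \<forall>y\<in>dom \<alpha>. x \<le> y \<longrightarrow> the (\<alpha> x) \<le> the (\<alpha> y))"

definition order_decreasing :: "ptrans \<Rightarrow> bool" where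
  "order_decreasing \<alpha> \<longleftrightarrow> (\<forall>x\<in>dom \<alpha>. the (\<alpha> x) \<le> x)"

definition height :: "ptrans \<Rightarrow> nat" where
  "height \<alpha> = card (ran \<alpha>)"

definition LS :: "nat \<Rightarrow> ptrans set" where
  "LS n = {\<alpha>. partial_transformation n \<alpha> \<and> isotone \<alpha> \<and> order_decreasing \<alpha>}"

definition SS :: "nat \<Rightarrow> ptrans set" where
  "SS n = {\<alpha> \<in> LS n. 1 \<in> dom \<alpha>}"

text \<open>Maps act on the right, so the product \<open>\<alpha>\<beta>\<close> applies \<open>\<alpha>\<close> first; \<^const>\<open>map_comp\<close>
  applies its second argument first.\<close>

definition pmul :: "ptrans \<Rightarrow> ptrans \<Rightarrow> ptrans" where
  "pmul \<alpha> \<beta> = \<beta> \<circ>\<^sub>m \<alpha>"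

definition K :: "nat \<Rightarrow> nat \<Rightarrow> ptrans sgrp" where
  "K n p = \<lparr> carrier = {\<alpha> \<in> LS n. height \<alpha> \<le> p}, mult = pmul \<rparr>"

definition M :: "nat \<Rightarrow> nat \<Rightarrow> ptrans sgrp" where
  "M n p = \<lparr> carrier = {\<alpha> \<in> SS n. height \<alpha> \<le> p}, mult = pmul \<rparr>"

definition RLS :: "nat \<Rightarrow> nat \<Rightarrow> ptrans option sgrp" where
  "RLS n p = rees_quotient (K n p) (carrier (K n (p - 1)))"

definition RSS :: "nat \<Rightarrow> nat \<Rightarrow> ptrans option sgrp" where
  "RSS n p = rees_quotient (M n p) (carrier (M n (p - 1)))"

text \<open>Height of an element of a Rees quotient; the zero has none.\<close>

definition rees_height :: "ptrans option \<Rightarrow> nat option" where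
  "rees_height x = map_option height x"

text \<open>The structures above are semigroups, and the quotients are taken by ideals.\<close>

lemma pmul_assoc: "pmul (pmul \<alpha> \<beta>) \<gamma> = pmul \<alpha> (pmul \<beta> \<gamma>)"
  by (rule ext) (simp add: pmul_def map_comp_def split: option.split)

lemma pmul_eq_Some: "pmul \<alpha> \<beta> x = Some z \<longleftrightarrow> (\<exists>y. \<alpha> x = Some y \<and> \<beta> y = Some z)"
  by (auto simp: pmul_def map_comp_Some_iff)

lemma LS_iff:
  "\<alpha> \<in> LS n \<longleftrightarrow>
     (\<forall>x y. \<alpha> x = Some y \<longrightarrow> 1 \<le> y \<and> y \<le> x \<and> x \<le> n) \<and>
     (\<forall>x x' y y'. \<alpha> x = Some y \<longrightarrow> \<alpha> x' = Some y' \<longrightarrow> x \<le> x' \<longrightarrow> y \<le> y')"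
  (is "?L \<longleftrightarrow> ?R")
proof
  assume L: ?L
  then have iso: "isotone \<alpha>" by (simp add: LS_def)
  have "1 \<le> y \<and> y \<le> x \<and> x \<le> n" if "\<alpha> x = Some y" for x y
  proof -
    have "x \<in> dom \<alpha>" "y \<in> ran \<alpha>" "the (\<alpha> x) = y"
      using that by (auto intro: ranI)
    then show ?thesis
      using L unfolding LS_def partial_transformation_def order_decreasing_def by auto
  qed
  moreover have "y \<le> y'" if "\<alpha> x = Some y" "\<alpha> x' = Some y'" "x \<le> x'" for x x' y y'
    using iso[unfolded isotone_def, rule_format, of x x'] that by (simp add: domI)
  ultimately show ?R by blast
next
  assume R: ?R
  then have b: "1 \<le> y \<and> y \<le> x \<and> x \<le> n" if "\<alpha> x = Some y" for x y
    using that by blast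
  have "dom \<alpha> \<subseteq> {1..n}" "ran \<alpha> \<subseteq> {1..n}"
    using b by (auto simp: dom_def ran_def intro: order_trans dest: b)
  moreover have "order_decreasing \<alpha>"
    using b unfolding order_decreasing_def by auto
  moreover have "isotone \<alpha>"
    using R unfolding isotone_def by auto
  ultimately show ?L
    by (simp add: LS_def partial_transformation_def)
qed

lemma pmul_LS: "\<lbrakk>\<alpha> \<in> LS n; \<beta> \<in> LS n\<rbrakk> \<Longrightarrow> pmul \<alpha> \<beta> \<in> LS n"
  unfolding LS_iff pmul_eq_Some by (meson order_trans)

lemma SS_fix_one: "\<alpha> \<in> SS n \<longleftrightarrow> \<alpha> \<in> LS n \<and> \<alpha> 1 = Some 1"
  unfolding SS_def LS_iff by (auto simp: dom_def) (metis One_nat_def le_antisym)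

lemma pmul_SS: "\<lbrakk>\<alpha> \<in> SS n; \<beta> \<in> SS n\<rbrakk> \<Longrightarrow> pmul \<alpha> \<beta> \<in> SS n"
  unfolding SS_fix_one by (auto intro: pmul_LS simp: pmul_eq_Some)

lemma finite_ran_LS: "\<alpha> \<in> LS n \<Longrightarrow> finite (ran \<alpha>)"
  unfolding LS_def partial_transformation_def by (auto intro: finite_subset)

lemma SS_imp_LS: "\<alpha> \<in> SS n \<Longrightarrow> \<alpha> \<in> LS n"
  by (simp add: SS_def)

lemma height_pmul_right: "\<beta> \<in> LS n \<Longrightarrow> height (pmul \<alpha> \<beta>) \<le> height \<beta>"
  unfolding height_def
  by (rule card_mono[OF finite_ran_LS]) (auto simp: ran_def pmul_eq_Some)

lemma height_pmul_left:
  assumes "\<alpha> \<in> LS n"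
  shows "height (pmul \<alpha> \<beta>) \<le> height \<alpha>"
proof -
  have "ran (pmul \<alpha> \<beta>) \<subseteq> (\<lambda>y. the (\<beta> y)) ` ran \<alpha>"
    by (force simp: ran_def pmul_eq_Some)
  then show ?thesis
    unfolding height_def using assms finite_ran_LS
    by (meson card_image_le card_mono finite_imageI order_trans)
qed

lemma semigroup_K: "semigroup_on (K n p)"
  by (auto simp: semigroup_on_def K_def pmul_assoc pmul_LS
      intro: order_trans[OF height_pmul_right])

lemma semigroup_M: "semigroup_on (M n p)"
  by (auto simp: semigroup_on_def M_def pmul_assoc pmul_SS SS_imp_LS
      intro: order_trans[OF height_pmul_right[OF SS_imp_LS]])

lemma ideal_K: "q \<le> p \<Longrightarrow> two_sided_ideal (K n p) (carrier (K n q))"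
  by (auto simp: two_sided_ideal_def K_def pmul_LS
      intro: order_trans[OF height_pmul_right] order_trans[OF height_pmul_left])

lemma ideal_M: "q \<le> p \<Longrightarrow> two_sided_ideal (M n p) (carrier (M n q))"
  by (auto simp: two_sided_ideal_def M_def pmul_SS SS_imp_LS
      intro: order_trans[OF height_pmul_right[OF SS_imp_LS]] order_trans[OF height_pmul_left[OF SS_imp_LS]])

lemma semigroup_rees_quotient:
  assumes "semigroup_on S" "two_sided_ideal S I"
  shows "semigroup_on (rees_quotient S I)"
proof -
  have "mult S x y \<in> carrier S" if "x \<in> carrier S" "y \<in> carrier S" for x y
    using assms that by (simp add: semigroup_on_def)
  moreover have "mult S (mult S x y) z = mult S x (mult S y z)"
    if "x \<in> carrier S" "y \<in> carrier S" "z \<in> carrier S" for x y z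
    using assms that by (simp add: semigroup_on_def)
  moreover have "mult S s x \<in> I" "mult S x s \<in> I" if "x \<in> I" "s \<in> carrier S" for x s
    using assms that by (auto simp: two_sided_ideal_def)
  ultimately show ?thesis
    unfolding semigroup_on_def rees_quotient_def
    by (auto split: option.splits if_splits) metis+
qed

lemma carrier_RLS: "1 \<le> p \<Longrightarrow> carrier (RLS n p) = insert None (Some ` {\<alpha> \<in> LS n. height \<alpha> = p})"
  by (auto simp: RLS_def rees_quotient_def K_def)

lemma carrier_RSS: "1 \<le> p \<Longrightarrow> carrier (RSS n p) = insert None (Some ` {\<alpha> \<in> SS n. height \<alpha> = p})"
  by (auto simp: RSS_def rees_quotient_def M_def)

end

theory Submission
  imports Defs
begin

text \<open>Let \<open>\<alpha>\<close> have image \<open>a\<^sub>1 < \<dots> < a\<^sub>p\<close>, and let \<open>m\<^sub>i \<ge> a\<^sub>i\<close> be the least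
  preimage of \<open>a\<^sub>i\<close>. The map with the kernel of \<open>\<alpha>\<close> that sends the \<open>i\<close>-th block to \<open>m\<^sub>i\<close> is
  idempotent. Moving \<open>m\<^sub>1\<close> to \<open>a\<^sub>1\<close>, then \<open>m\<^sub>2\<close> to \<open>a\<^sub>2\<close>, and so on, turns it into \<open>\<alpha>\<close>. The \<open>i\<close>-th
  move is right multiplication by the idempotent that fixes \<open>a\<^sub>1, \<dots>, a\<^sub>i, m\<^bsub>i+1\<^esub>, \<dots>, m\<^sub>p\<close> and
  maps \<open>m\<^sub>i\<close> to \<open>a\<^sub>i\<close>, which has height \<open>p\<close>.\<close>

section \<open>Products built up by right multiplication\<close>

lemma products_of_base: "e \<in> A \<Longrightarrow> e \<in> products_of S A"
  unfolding products_of_def by (force intro: exI[of _ "[]"])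

lemma products_of_mult:
  assumes "x \<in> products_of S A" "e \<in> A"
  shows "mult S x e \<in> products_of S A"
proof -
  obtain d ds where "x = foldl (mult S) d ds" "d \<in> A" "set ds \<subseteq> A"
    using assms(1) unfolding products_of_def by blast
  then have "mult S x e = foldl (mult S) d (ds @ [e])" "d \<in> A" "set (ds @ [e]) \<subseteq> A"
    using assms(2) by auto
  then show ?thesis
    unfolding products_of_def by blast
qed

section \<open>Least preimages and partially lifted maps\<close>

definition block_min :: "ptrans \<Rightarrow> nat \<Rightarrow> nat" where
  "block_min \<alpha> y = (LEAST x. \<alpha> x = Some y)"

lemma block_min_Some: "\<alpha> x = Some y \<Longrightarrow> \<alpha> (block_min \<alpha> y) = Some y"
  unfolding block_min_def by (rule LeastI)

lemma block_min_le: "\<alpha> x = Some y \<Longrightarrow> block_min \<alpha> y \<le> x"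
  unfolding block_min_def by (rule Least_le)

lemma le_block_min: "\<lbrakk>\<alpha> \<in> LS n; y \<in> ran \<alpha>\<rbrakk> \<Longrightarrow> y \<le> block_min \<alpha> y"
  unfolding LS_iff ran_def using block_min_Some by blast

lemma block_min_less:
  assumes "\<alpha> \<in> LS n" "y \<in> ran \<alpha>" "y' \<in> ran \<alpha>" "y < y'"
  shows "block_min \<alpha> y < block_min \<alpha> y'"
proof (rule ccontr)
  assume "\<not> ?thesis"
  then have "block_min \<alpha> y' \<le> block_min \<alpha> y" by simp
  moreover have "\<alpha> (block_min \<alpha> y) = Some y" "\<alpha> (block_min \<alpha> y') = Some y'"
    using assms(2,3) block_min_Some unfolding ran_def by blast+
  ultimately have "y' \<le> y"
    using assms(1) unfolding LS_iff by blast
  then show False using assms(4) by simp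
qed

text \<open>The parameter \<open>k\<close> is a threshold on values, not an index into the image:
  values up to \<open>k\<close> are already in final position. Thus \<open>k\<close> can run through
  all naturals.\<close>

definition lift_above :: "ptrans \<Rightarrow> nat \<Rightarrow> nat \<Rightarrow> nat" where
  "lift_above \<alpha> k y = (if y \<le> k then y else block_min \<alpha> y)"

definition partial_lift :: "ptrans \<Rightarrow> nat \<Rightarrow> ptrans" where
  "partial_lift \<alpha> k = map_option (lift_above \<alpha> k) \<circ> \<alpha>"

lemma partial_lift_Some:
  "partial_lift \<alpha> k x = Some z \<longleftrightarrow> (\<exists>y. \<alpha> x = Some y \<and> z = lift_above \<alpha> k y)"
  by (auto simp: partial_lift_def)

text \<open>In the mixed case y \<le> k < y' the bound y' \<le> \<open>block_min \<alpha> y'\<close>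
  suffices. Strictness yields injectivity, hence the height, and also isotonicity of the
  lifts.\<close>

lemma lift_above_less:
  assumes "\<alpha> \<in> LS n" "y \<in> ran \<alpha>" "y' \<in> ran \<alpha>" "y < y'"
  shows "lift_above \<alpha> k y < lift_above \<alpha> k y'"
  using block_min_less[OF assms] le_block_min[OF assms(1,3)] assms(4)
  by (auto simp: lift_above_def)

lemma ran_partial_lift: "ran (partial_lift \<alpha> k) = lift_above \<alpha> k ` ran \<alpha>"
  by (auto simp: ran_def partial_lift_Some)

lemma height_partial_lift:
  assumes "\<alpha> \<in> LS n"
  shows "height (partial_lift \<alpha> k) = height \<alpha>"
proof -
  have "inj_on (lift_above \<alpha> k) (ran \<alpha>)"
    by (rule inj_onI) (metis lift_above_less[OF assms] less_irrefl linorder_neqE_nat)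
  then show ?thesis
    unfolding height_def ran_partial_lift by (rule card_image)
qed

lemma partial_lift_LS:
  assumes \<alpha>: "\<alpha> \<in> LS n"
  shows "partial_lift \<alpha> k \<in> LS n"
proof -
  have "1 \<le> z \<and> z \<le> x \<and> x \<le> n" if xz: "partial_lift \<alpha> k x = Some z" for x z
  proof -
    obtain y where y: "\<alpha> x = Some y" "z = lift_above \<alpha> k y"
      using xz by (auto simp: partial_lift_Some)
    then have "1 \<le> y" "y \<le> x" "x \<le> n" "y \<le> block_min \<alpha> y" "block_min \<alpha> y \<le> x"
      using \<alpha> le_block_min[OF \<alpha> ranI] block_min_le unfolding LS_iff by blast+
    then show ?thesis using y(2) by (auto simp: lift_above_def)
  qed
  moreover have "z \<le> z'"
    if xz: "partial_lift \<alpha> k x = Some z" "partial_lift \<alpha> k x' = Some z'" "x \<le> x'" for x x' z z'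
  proof -
    obtain y y' where y: "\<alpha> x = Some y" "z = lift_above \<alpha> k y" "\<alpha> x' = Some y'" "z' = lift_above \<alpha> k y'"
      using xz(1,2) by (auto simp: partial_lift_Some)
    then have "y \<le> y'" using \<alpha> xz(3) unfolding LS_iff by blast
    then show ?thesis
      using y lift_above_less[OF \<alpha>, of y y' k] by (cases "y = y'") (auto simp: ranI)
  qed
  ultimately show ?thesis unfolding LS_iff by blast
qed

lemma partial_lift_SS: "\<alpha> \<in> SS n \<Longrightarrow> partial_lift \<alpha> k \<in> SS n"
  using partial_lift_LS[of \<alpha> n k] by (auto simp: SS_def dom_def partial_lift_Some)

text \<open>All values are at least 1, so threshold 0 lifts every one of them. A block minimum lies
  in its own block and is therefore fixed.\<close>

lemma partial_lift_0_idem: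
  assumes \<alpha>: "\<alpha> \<in> LS n"
  shows "pmul (partial_lift \<alpha> 0) (partial_lift \<alpha> 0) = partial_lift \<alpha> 0"
proof (rule map_le_antisym)
  have "pmul (partial_lift \<alpha> 0) (partial_lift \<alpha> 0) x = Some z"
    if xz: "partial_lift \<alpha> 0 x = Some z" for x z
  proof -
    obtain y where y: "\<alpha> x = Some y" "z = lift_above \<alpha> 0 y"
      using xz by (auto simp: partial_lift_Some)
    have "1 \<le> y" using \<alpha> y(1) unfolding LS_iff by blast
    then have "z = block_min \<alpha> y" using y(2) by (simp add: lift_above_def)
    then have "partial_lift \<alpha> 0 z = Some z"
      using y block_min_Some[of \<alpha>, OF y(1)] by (auto simp: partial_lift_Some)
    then show ?thesis using xz by (simp add: pmul_eq_Some)
  qed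
  then show "partial_lift \<alpha> 0 \<subseteq>\<^sub>m pmul (partial_lift \<alpha> 0) (partial_lift \<alpha> 0)"
    by (auto simp: map_le_def)
  \<comment> \<open>A composite is defined only where its first factor is, and there the inclusion
    just shown determines its value.\<close>
  then show "pmul (partial_lift \<alpha> 0) (partial_lift \<alpha> 0) \<subseteq>\<^sub>m partial_lift \<alpha> 0"
    by (auto simp: map_le_def pmul_eq_Some dom_def)
qed

lemma partial_lift_top: "\<alpha> \<in> LS n \<Longrightarrow> partial_lift \<alpha> n = \<alpha>"
proof (rule ext)
  fix x assume "\<alpha> \<in> LS n"
  then have "y \<le> n" if "\<alpha> x = Some y" for y
    using that unfolding LS_iff by (meson order_trans)
  then show "partial_lift \<alpha> n x = \<alpha> x"
    by (cases "\<alpha> x") (auto simp: partial_lift_def lift_above_def)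
qed

section \<open>Lowering the values one at a time\<close>

definition collapse :: "nat set \<Rightarrow> nat \<Rightarrow> nat \<Rightarrow> ptrans" where
  "collapse D c m y = (if y \<in> D then Some (if c \<le> y \<and> y \<le> m then c else y) else None)"

text \<open>Sending all of \<open>D\<close> between \<open>c\<close> and \<open>m\<close> to
  \<open>c\<close>, not just \<open>m\<close>, makes the map isotone whatever else \<open>D\<close>
  contains. In the application \<open>D\<close> meets this interval only in \<open>c\<close> and
  \<open>m\<close>.\<close>

lemma collapse_LS: "D \<subseteq> {1..n} \<Longrightarrow> c \<in> D \<Longrightarrow> collapse D c m \<in> LS n"
  unfolding LS_iff collapse_def by (auto split: if_splits)

lemma collapse_idem: "c \<in> D \<Longrightarrow> pmul (collapse D c m) (collapse D c m) = collapse D c m"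
  by (auto simp: pmul_def map_comp_def collapse_def fun_eq_iff)

text \<open>The point \<open>Suc k\<close> is a value of the lift only if it equals its own block
  minimum. It is inserted into the domain of \<open>e\<close> so that \<open>e\<close> fixes its
  image and is idempotent.\<close>

lemma partial_lift_Suc:
  assumes \<alpha>: "\<alpha> \<in> LS n" and c: "Suc k \<in> ran \<alpha>"
  defines "e \<equiv> collapse (insert (Suc k) (ran (partial_lift \<alpha> k))) (Suc k) (block_min \<alpha> (Suc k))"
  shows "partial_lift \<alpha> (Suc k) = pmul (partial_lift \<alpha> k) e"
    and "ran e = ran (partial_lift \<alpha> (Suc k))"
proof -
  let ?m = "block_min \<alpha> (Suc k)"
  have m: "Suc k \<le> ?m" by (rule le_block_min[OF \<alpha> c])
  have *: "e (lift_above \<alpha> k y) = Some (lift_above \<alpha> (Suc k) y)" if y: "y \<in> ran \<alpha>" for y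
  proof -
    have D: "lift_above \<alpha> k y \<in> ran (partial_lift \<alpha> k)"
      using y by (simp add: ran_partial_lift)
    \<comment> \<open>Values up to \<open>k\<close> stay below the collapsed interval,
      \<open>Suc k\<close> has been lifted to its right end \<open>?m\<close>, and larger values
      have been lifted beyond \<open>?m\<close>.\<close>
    consider "y \<le> k" | "y = Suc k" | "Suc k < y" by linarith
    then show ?thesis
    proof cases
      case 3
      then show ?thesis using block_min_less[OF \<alpha> c y] D
        by (auto simp: e_def collapse_def lift_above_def)
    qed (use D m in \<open>auto simp: e_def collapse_def lift_above_def\<close>)
  qed
  show "partial_lift \<alpha> (Suc k) = pmul (partial_lift \<alpha> k) e"
  proof
    fix x
    show "partial_lift \<alpha> (Suc k) x = pmul (partial_lift \<alpha> k) e x"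
      by (cases "\<alpha> x") (auto simp: partial_lift_def pmul_def map_comp_def * ranI)
  qed
  have "dom e = insert (Suc k) (lift_above \<alpha> k ` ran \<alpha>)"
    by (auto simp: e_def collapse_def dom_def ran_partial_lift)
  moreover have "e (Suc k) = Some (Suc k)"
    using m by (simp add: e_def collapse_def)
  \<comment> \<open>So the inserted domain point contributes no value outside the new image.\<close>
  moreover have "Suc k = lift_above \<alpha> (Suc k) (Suc k)" by (simp add: lift_above_def)
  moreover have "ran e = (\<lambda>y. the (e y)) ` dom e"
    by (force simp: ran_def dom_def)
  ultimately show "ran e = ran (partial_lift \<alpha> (Suc k))"
    using c by (auto simp: ran_partial_lift * image_image)
qed

text \<open>An abstract \<open>P\<close> lets one argument serve the ideals and their Rees
  quotients. The premise on the height of \<open>pmul \<beta> e\<close> is what keeps the product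
  nonzero in a quotient.\<close>

lemma idempotent_product_induct [consumes 2, case_names idem mult]:
  assumes T: "T = LS n \<or> T = SS n" and \<alpha>: "\<alpha> \<in> T"
    and idem: "\<And>e. \<lbrakk>e \<in> T; pmul e e = e; height e = height \<alpha>\<rbrakk> \<Longrightarrow> P e"
    and mult: "\<And>\<beta> e. \<lbrakk>P \<beta>; e \<in> T; pmul e e = e; height e = height \<alpha>; height (pmul \<beta> e) = height \<alpha>\<rbrakk>
      \<Longrightarrow> P (pmul \<beta> e)"
  shows "P \<alpha>"
proof -
  have LS: "\<alpha> \<in> LS n" using T \<alpha> SS_imp_LS by blast
  have T': "partial_lift \<alpha> k \<in> T" for k
    using T \<alpha> partial_lift_LS partial_lift_SS by blast
  have "P (partial_lift \<alpha> k)" for k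
  proof (induction k)
    case 0
    show ?case by (intro idem T' partial_lift_0_idem[OF LS] height_partial_lift[OF LS])
  next
    case (Suc k)
    show ?case
    proof (cases "Suc k \<in> ran \<alpha>")
      \<comment> \<open>No block has value \<open>Suc k\<close>, so raising the threshold moves
        nothing.\<close>
      case False
      then have "partial_lift \<alpha> (Suc k) = partial_lift \<alpha> k"
        by (auto simp: partial_lift_def lift_above_def fun_eq_iff le_Suc_eq ran_def
            intro!: option.map_cong0 split: option.splits)
      then show ?thesis using Suc by simp
    next
      case True
      define D where "D = insert (Suc k) (ran (partial_lift \<alpha> k))"
      define e where "e = collapse D (Suc k) (block_min \<alpha> (Suc k))"
      note step = partial_lift_Suc[OF LS True, folded D_def, folded e_def]
      have "ran \<alpha> \<subseteq> {1..n}" "ran (partial_lift \<alpha> k) \<subseteq> {1..n}"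
        using LS partial_lift_LS[OF LS, of k] by (simp_all add: LS_def partial_transformation_def)
      then have eLS: "e \<in> LS n"
        unfolding e_def D_def using True by (intro collapse_LS) auto
      moreover have "e \<in> SS n" if "T = SS n"
      proof -
        \<comment> \<open>Members of \<open>SS n\<close> fix 1, so 1 is a value of the lift and
          hence a domain point of \<open>e\<close>.\<close>
        have "1 \<in> ran (partial_lift \<alpha> k)"
          using T' that SS_fix_one by (auto intro: ranI)
        then have "1 \<in> dom e" by (simp add: e_def D_def collapse_def dom_def)
        then show ?thesis using eLS by (simp add: SS_def)
      qed
      ultimately have "e \<in> T" using T by blast
      moreover have "pmul e e = e"
        unfolding e_def D_def by (rule collapse_idem) simp
      moreover have "height e = height \<alpha>"
        using step(2) height_partial_lift[OF LS] by (simp add: height_def)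
      ultimately show ?thesis
        using mult[OF Suc] step(1) height_partial_lift[OF LS, of "Suc k"] by simp
    qed
  qed
  then show ?thesis using partial_lift_top[OF LS] by metis
qed

section \<open>Transfer to the four semigroups\<close>

lemma products_of_idempotents:
  assumes T: "T = LS n \<or> T = SS n" and \<alpha>: "\<alpha> \<in> T" and p: "height \<alpha> = p"
    and S: "S = \<lparr>carrier = {\<beta> \<in> T. height \<beta> \<le> p}, mult = pmul\<rparr>"
  shows "\<alpha> \<in> products_of S {e \<in> idempotents S. height e = p}"
  using T \<alpha>
proof (induction rule: idempotent_product_induct)
  case (idem e)
  then show ?case by (intro products_of_base) (simp add: p S idempotents_def)
next
  case (mult \<beta> e)
  then show ?case
    using products_of_mult[OF mult(1), of e] by (simp add: p S idempotents_def)
qed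

lemma rees_products_of_idempotents:
  assumes T: "T = LS n \<or> T = SS n" and \<alpha>: "\<alpha> \<in> T" and p: "height \<alpha> = p" and pos: "1 \<le> p"
    and S: "S = rees_quotient \<lparr>carrier = {\<beta> \<in> T. height \<beta> \<le> p}, mult = pmul\<rparr>
      {\<beta> \<in> T. height \<beta> \<le> p - 1}"
  shows "Some \<alpha> \<in> products_of S {e \<in> idempotents S. rees_height e = Some p}"
    (is "_ \<in> products_of S ?E")
proof -
  \<comment> \<open>Subtraction is truncated; \<open>pos\<close> ensures p - 1 < p, so maps of
    height \<open>p\<close> lie outside the ideal.\<close>
  have E: "Some e \<in> ?E" if "e \<in> T" "pmul e e = e" "height e = p" for e
    using that pos by (auto simp: S rees_quotient_def idempotents_def rees_height_def)
  have mult_S: "mult S (Some \<beta>) (Some e) = Some (pmul \<beta> e)" if "height (pmul \<beta> e) = p" for \<beta> e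
    using that pos by (auto simp: S rees_quotient_def)
  show ?thesis
    using T \<alpha>
  proof (induction rule: idempotent_product_induct)
    case (idem e)
    then show ?case by (intro products_of_base E) (simp_all add: p)
  next
    case (mult \<beta> e)
    then show ?case
      using products_of_mult[OF mult(1) E, of e] by (simp add: p mult_S)
  qed
qed

theorem lemma3p3:
  fixes n p :: nat
  assumes "1 \<le> p" and "p \<le> n"
  shows "(2 \<le> p \<longrightarrow>
            (\<forall>x \<in> carrier (RSS n p). rees_height x = Some p \<longrightarrow>
               x \<in> products_of (RSS n p) {e \<in> idempotents (RSS n p). rees_height e = Some p}))
       \<and> (\<forall>x \<in> carrier (RLS n p). rees_height x = Some p \<longrightarrow>
            x \<in> products_of (RLS n p) {e \<in> idempotents (RLS n p). rees_height e = Some p})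
       \<and> (\<forall>\<alpha> \<in> carrier (K n p). height \<alpha> = p \<longrightarrow>
            \<alpha> \<in> products_of (K n p) {e \<in> idempotents (K n p). height e = p})
       \<and> (\<forall>\<alpha> \<in> carrier (M n p). height \<alpha> = p \<longrightarrow>
            \<alpha> \<in> products_of (M n p) {e \<in> idempotents (M n p). height e = p})"
proof (intro conjI impI ballI)
  fix x assume "x \<in> carrier (RSS n p)" "rees_height x = Some p"
  \<comment> \<open>The zero \<open>None\<close> has no height, so \<open>x\<close> is the class of
    an actual map.\<close>
  then obtain \<alpha> where "x = Some \<alpha>" "\<alpha> \<in> SS n" "height \<alpha> = p"
    using carrier_RSS[OF assms(1)] by (auto simp: rees_height_def)
  then show "x \<in> products_of (RSS n p) {e \<in> idempotents (RSS n p). rees_height e = Some p}"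
    using rees_products_of_idempotents[of "SS n" n \<alpha> p "RSS n p"] assms(1)
    by (simp add: RSS_def M_def)
next
  fix x assume "x \<in> carrier (RLS n p)" "rees_height x = Some p"
  then obtain \<alpha> where "x = Some \<alpha>" "\<alpha> \<in> LS n" "height \<alpha> = p"
    using carrier_RLS[OF assms(1)] by (auto simp: rees_height_def)
  then show "x \<in> products_of (RLS n p) {e \<in> idempotents (RLS n p). rees_height e = Some p}"
    using rees_products_of_idempotents[of "LS n" n \<alpha> p "RLS n p"] assms(1)
    by (simp add: RLS_def K_def)
next
  fix \<alpha> assume "\<alpha> \<in> carrier (K n p)" "height \<alpha> = p"
  then show "\<alpha> \<in> products_of (K n p) {e \<in> idempotents (K n p). height e = p}"
    using products_of_idempotents[of "LS n" n \<alpha> p "K n p"] by (simp add: K_def)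
next
  fix \<alpha> assume "\<alpha> \<in> carrier (M n p)" "height \<alpha> = p"
  then show "\<alpha> \<in> products_of (M n p) {e \<in> idempotents (M n p). height e = p}"
    using products_of_idempotents[of "SS n" n \<alpha> p "M n p"] by (simp add: M_def)
qed

end
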